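(* Let $(G,r)$ be a connected locally finite network. If $G$ has a cut $F$ such that $\sum_{e\in F}1/r(e)$ is finite, and there are two (distinct) components of $G-F$ each containing a transient network, then $(G,r)$ is not in $\mathcal{O}_{HD}$.
   Context: A network is a pair $(G,r)$ where $G$ is an undirected multigraph and $r:E(G)\to\mathbb{R}_{>0}$ assigns a resistance to every edge; $c(e)=1/r(e)$ is the conductance. It is locally finite if every vertex of $G$ is incident with only finitely many edges. A component contains a transient network if it has a subgraph which, with the restriction of $r$, is a transient network. A cut is the set of all edges between the two sides of a bipartition of $V(G)$ into two non-empty sets; $G-F$ is $G$ with the edges of $F$ deleted. A directed edge is a triple $\vec e=(e,x,y)$ with $e$ an edge with end-vertices $x\neq y$; $init(\vec e)=x$, $ter(\vec e)=y$, and its reverse is $\overleftarrow{e}=(e,y,x)$. A function $\varphi$ on directed edges is antisymmetric if $\varphi(\vec e)=-\varphi(\overleftarrow{e})$ for all $\vec e$. Its accumulation at a vertex $v$ is $\sum_{\vec e:\, ter(\vec e)=v}\varphi(\vec e)$, and it satisfies (K1) at $v$ if this is $0$. Its energy is $\sum_{e\in E} r(e)\varphi(\vec e)^2$ (one orientation per edge). A $v$-flow of intensity $I$ is an antisymmetric function having accumulation $I$ at $v$ and satisfying (K1) at every other vertex. A network is transient if for some vertex $v$ there is a $v$-flow of non-zero intensity with finite energy in it. A potential is a function $h:V(G)\to\mathbb{R}$; its energy is $\sum_{e=vw\in E(G)} (h(v)-h(w))^2/r(e)$. A potential $h$ is harmonic if for every vertex $v$ the value $h(v)$ is the average of the values of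 $h$ at its neighbours weighted by conductances, i.e. $\sum_{e=vw}c(e)(h(v)-h(w))=0$ (sum over edges $e$ incident with $v$). A network is in $\mathcal{O}_{HD}$ if every harmonic function of finite energy on it is constant. *)

theory Defs
  imports "HOL-Analysis.Infinite_Sum"
begin

text \<open>
  Undirected multigraphs with resistances. The set of end-vertices of an edge has two elements,
  or one if the edge is a loop. The values of \<open>ends\<close> and \<open>res\<close> outside \<open>edges\<close> are irrelevant,
  so a subnetwork keeps these two fields instead of restricting them.
\<close>

record ('v, 'e) network =
  verts :: "'v set"
  edges :: "'e set"
  ends  :: "'e \<Rightarrow> 'v set"
  res   :: "'e \<Rightarrow> real"

definition is_network :: "('v, 'e) network \<Rightarrow> bool" where
  "is_network N \<longleftrightarrow>
     (\<forall>e\<in>edges N. ends N e \<subseteq> verts N \<and> card (ends N e) \<in> {1, 2} \<and> res N e > 0)"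

definition cond :: "('v, 'e) network \<Rightarrow> 'e \<Rightarrow> real" where
  "cond N e = 1 / res N e"

definition locally_finite :: "('v, 'e) network \<Rightarrow> bool" where
  "locally_finite N \<longleftrightarrow> (\<forall>v\<in>verts N. finite {e\<in>edges N. v \<in> ends N e})"

definition subnetwork :: "('v, 'e) network \<Rightarrow> ('v, 'e) network \<Rightarrow> bool" where
  "subnetwork H N \<longleftrightarrow>
     is_network H \<and> verts H \<subseteq> verts N \<and> edges H \<subseteq> edges N \<and> ends H = ends N \<and> res H = res N"

definition adjacent :: "('v, 'e) network \<Rightarrow> 'v \<Rightarrow> 'v \<Rightarrow> bool" where
  "adjacent N x y \<longleftrightarrow> (\<exists>e\<in>edges N. ends N e = {x, y})"

definition net_connected :: "('v, 'e) network \<Rightarrow> bool" where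
  "net_connected N \<longleftrightarrow>
     verts N \<noteq> {} \<and> (\<forall>x\<in>verts N. \<forall>y\<in>verts N. (adjacent N)\<^sup>*\<^sup>* x y)"

definition net_components :: "('v, 'e) network \<Rightarrow> ('v, 'e) network set" where
  "net_components N =
     {C. subnetwork C N \<and> net_connected C \<and>
         (\<forall>D. subnetwork D N \<and> net_connected D \<and> subnetwork C D \<longrightarrow> D = C)}"

definition delete_edges :: "('v, 'e) network \<Rightarrow> 'e set \<Rightarrow> ('v, 'e) network" where
  "delete_edges N F = N\<lparr>edges := edges N - F\<rparr>"

definition is_cut :: "('v, 'e) network \<Rightarrow> 'e set \<Rightarrow> bool" where
  "is_cut N F \<longleftrightarrow>
     (\<exists>A B. A \<noteq> {} \<and> B \<noteq> {} \<and> A \<inter> B = {} \<and> A \<union> B = verts N \<and>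
            F = {e\<in>edges N. \<exists>x\<in>A. \<exists>y\<in>B. ends N e = {x, y}})"

type_synonym ('v, 'e) dedge = "'e \<times> 'v \<times> 'v"

definition edge_of :: "('v, 'e) dedge \<Rightarrow> 'e" where "edge_of d = fst d"
definition init :: "('v, 'e) dedge \<Rightarrow> 'v" where "init d = fst (snd d)"
definition ter :: "('v, 'e) dedge \<Rightarrow> 'v" where "ter d = snd (snd d)"

definition dedges :: "('v, 'e) network \<Rightarrow> ('v, 'e) dedge set" where
  "dedges N = {(e, x, y) | e x y. e \<in> edges N \<and> ends N e = {x, y} \<and> x \<noteq> y}"

definition antisymmetric :: "('v, 'e) network \<Rightarrow> (('v, 'e) dedge \<Rightarrow> real) \<Rightarrow> bool" where
  "antisymmetric N \<phi> \<longleftrightarrow> (\<forall>(e, x, y)\<in>dedges N. \<phi> (e, x, y) = - \<phi> (e, y, x))"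

text \<open>
  The sums over the edges at a vertex, here and in \<open>harmonic\<close>, are finite sums: they are
  meant for locally finite networks only (a property inherited by subnetworks).
\<close>

definition accumulation ::
  "('v, 'e) network \<Rightarrow> (('v, 'e) dedge \<Rightarrow> real) \<Rightarrow> 'v \<Rightarrow> real" where
  "accumulation N \<phi> v = (\<Sum>d | d \<in> dedges N \<and> ter d = v. \<phi> d)"

text \<open>
  An arbitrary orientation of each non-loop edge, used to write sums over undirected edges whose
  terms do not depend on the orientation. Loops have no orientation; they carry no flow and do
  not contribute to the energy of a potential.
\<close>

definition nonloops :: "('v, 'e) network \<Rightarrow> 'e set" where
  "nonloops N = {e\<in>edges N. card (ends N e) = 2}"

definition orient :: "('v, 'e) network \<Rightarrow> 'e \<Rightarrow> ('v, 'e) dedge" where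
  "orient N e = (SOME d. d \<in> dedges N \<and> edge_of d = e)"

text \<open>The energies are sums of nonnegative terms, so they are finite iff these are summable.\<close>

definition finite_flow_energy :: "('v, 'e) network \<Rightarrow> (('v, 'e) dedge \<Rightarrow> real) \<Rightarrow> bool" where
  "finite_flow_energy N \<phi> \<longleftrightarrow> (\<lambda>e. res N e * (\<phi> (orient N e))\<^sup>2) summable_on nonloops N"

definition is_flow ::
  "('v, 'e) network \<Rightarrow> 'v \<Rightarrow> real \<Rightarrow> (('v, 'e) dedge \<Rightarrow> real) \<Rightarrow> bool" where
  "is_flow N v I \<phi> \<longleftrightarrow>
     antisymmetric N \<phi> \<and> accumulation N \<phi> v = I \<and>
     (\<forall>w\<in>verts N - {v}. accumulation N \<phi> w = 0)"

definition transient :: "('v, 'e) network \<Rightarrow> bool" where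
  "transient N \<longleftrightarrow>
     (\<exists>v\<in>verts N. \<exists>I \<phi>. I \<noteq> 0 \<and> is_flow N v I \<phi> \<and> finite_flow_energy N \<phi>)"

definition contains_transient :: "('v, 'e) network \<Rightarrow> bool" where
  "contains_transient N \<longleftrightarrow> (\<exists>H. subnetwork H N \<and> transient H)"

definition finite_potential_energy :: "('v, 'e) network \<Rightarrow> ('v \<Rightarrow> real) \<Rightarrow> bool" where
  "finite_potential_energy N h \<longleftrightarrow>
     (\<lambda>e. (h (init (orient N e)) - h (ter (orient N e)))\<^sup>2 / res N e) summable_on nonloops N"

definition harmonic :: "('v, 'e) network \<Rightarrow> ('v \<Rightarrow> real) \<Rightarrow> bool" where
  "harmonic N h \<longleftrightarrow>
     (\<forall>v\<in>verts N. (\<Sum>d | d \<in> dedges N \<and> init d = v. cond N (edge_of d) * (h v - h (ter d))) = 0)"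

text \<open>Potentials are total functions of which only the values on \<open>verts\<close> matter.\<close>

definition O_HD :: "('v, 'e) network set" where
  "O_HD = {N. \<forall>h. harmonic N h \<and> finite_potential_energy N h \<longrightarrow> (\<exists>c. \<forall>v\<in>verts N. h v = c)}"

end

theory Submission
  imports Defs
begin

text \<open>
  The indicator function \<open>f\<close> of one of the two components has finite energy, because only edges of
  the cut leave that component. Projecting its gradient orthogonally onto the closure of the
  gradients of finitely supported potentials and taking the complement (Royden decomposition)
  gives potentials \<open>h\<^sub>n = f + g\<^sub>n\<close>, \<open>g\<^sub>n\<close> finitely supported, whose gradients converge in energy to
  the gradient of a harmonic function \<open>h\<close>. Pairing with a finite-energy flow out of \<open>v\<close> that lives
  where \<open>f\<close> is constant evaluates \<open>g\<^sub>n\<close> at \<open>v\<close>. If \<open>h\<close> were constant, these pairings would tend to 0,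
  so \<open>h\<^sub>n\<close> would tend to 1 at a vertex of one component and to 0 at a vertex of the other, while
  differences of values of \<open>h\<^sub>n\<close> tend to those of \<open>h\<close>.
\<close>

subsection \<open>Square summable functions\<close>

text \<open>A real quadratic that is never negative is tested at its vertex \<open>t = -P/B\<close>.
  This serves both Cauchy-Schwarz and the near orthogonality of minimizing sequences.\<close>

lemma discriminant_le:
  fixes A B P :: real
  assumes "\<And>t. 0 \<le> A + 2 * t * P + t\<^sup>2 * B"
  shows "P\<^sup>2 \<le> A * B"
proof (cases "B = 0")
  case True
  have "P = 0"
  proof (rule ccontr)
    assume "P \<noteq> 0"
    \<comment> \<open>At this \<open>t\<close> the remaining affine function takes the value
      -1.\<close>
    then have "2 * (- (A + 1) / (2 * P)) * P = - (A + 1)" by simp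
    then show False
      using assms[of "- (A + 1) / (2 * P)"] True by simp
  qed
  then show ?thesis using True by simp
next
  case False
  have "B > 0"
  proof (rule ccontr)
    assume "\<not> B > 0"
    then have "B < 0" using False by simp
    \<comment> \<open>Chosen so that \<open>t\<close> squared times \<open>B\<close> is -(|A| + 1).
      Adding the assumption at \<open>t\<close> and at \<open>-t\<close> cancels the linear term and
      leaves a negative number.\<close>
    define t where "t = sqrt ((\<bar>A\<bar> + 1) / - B)"
    have "(\<bar>A\<bar> + 1) / - B \<ge> 0" using \<open>B < 0\<close> by (intro divide_nonneg_pos) auto
    then have "t\<^sup>2 * B = - (\<bar>A\<bar> + 1)"
      unfolding t_def using \<open>B < 0\<close> by (simp add: field_simps)
    then show False using assms[of t] assms[of "-t"] by simp
  qed
  have "0 \<le> (A + 2 * (- P / B) * P + (- P / B)\<^sup>2 * B) * B"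
    using assms[of "- P / B"] \<open>B > 0\<close> by (intro mult_nonneg_nonneg) auto
  also have "\<dots> = A * B - P\<^sup>2"
    using \<open>B > 0\<close> by (simp add: field_simps power2_eq_square)
  finally show ?thesis by simp
qed

text \<open>Vectors are kept as total functions constrained only on \<open>S\<close>; functions that
  agree on \<open>S\<close> stand for the same vector.\<close>

definition ell2 :: "'e set \<Rightarrow> ('e \<Rightarrow> real) set" where
  "ell2 S = {a. (\<lambda>e. (a e)\<^sup>2) summable_on S}"

definition ell2_inner :: "'e set \<Rightarrow> ('e \<Rightarrow> real) \<Rightarrow> ('e \<Rightarrow> real) \<Rightarrow> real" where
  "ell2_inner S a b = (\<Sum>\<^sub>\<infinity>e\<in>S. a e * b e)"

text \<open>Comparison with the sum of the squares, by 2|ab| <= a^2 + b^2.\<close>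

lemma ell2_mult_summable:
  assumes "a \<in> ell2 S" "b \<in> ell2 S"
  shows "(\<lambda>e. a e * b e) summable_on S"
proof -
  have "(\<lambda>e. (a e)\<^sup>2 + (b e)\<^sup>2) summable_on S"
    using assms unfolding ell2_def by (auto intro: summable_on_add)
  then have "(\<lambda>e. \<bar>a e * b e\<bar>) summable_on S"
  proof (rule summable_on_comparison_test)
    fix e
    have "0 \<le> (\<bar>a e\<bar> - \<bar>b e\<bar>)\<^sup>2" by simp
    then have "2 * (\<bar>a e\<bar> * \<bar>b e\<bar>) \<le> (a e)\<^sup>2 + (b e)\<^sup>2"
      unfolding power2_diff by simp
    moreover have "0 \<le> \<bar>a e\<bar> * \<bar>b e\<bar>" by simp
    ultimately show "\<bar>a e * b e\<bar> \<le> (a e)\<^sup>2 + (b e)\<^sup>2"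
      unfolding abs_mult by linarith
  qed auto
  then show ?thesis
    by (subst summable_on_iff_abs_summable_on_real) (simp only: real_norm_def)
qed

lemma ell2_scale: "a \<in> ell2 S \<Longrightarrow> (\<lambda>e. t * a e) \<in> ell2 S"
  unfolding ell2_def mem_Collect_eq power_mult_distrib by (rule summable_on_cmult_right)

lemma ell2_add:
  assumes "a \<in> ell2 S" "b \<in> ell2 S"
  shows "(\<lambda>e. a e + b e) \<in> ell2 S"
proof -
  have "(\<lambda>e. (a e)\<^sup>2 + ((b e)\<^sup>2 + 2 * (a e * b e))) summable_on S"
    using assms ell2_mult_summable[OF assms] unfolding ell2_def mem_Collect_eq
    by (intro summable_on_add summable_on_cmult_right)
  then show ?thesis unfolding ell2_def mem_Collect_eq power2_sum by (simp only: ac_simps)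
qed

lemma ell2_diff:
  assumes "a \<in> ell2 S" "b \<in> ell2 S"
  shows "(\<lambda>e. a e - b e) \<in> ell2 S"
  using ell2_add[OF assms(1) ell2_scale[OF assms(2), of "-1"]] by simp

lemma ell2_inner_commute: "ell2_inner S a b = ell2_inner S b a"
  unfolding ell2_inner_def by (simp add: mult.commute)

lemma ell2_inner_self_nonneg: "0 \<le> ell2_inner S a a"
  unfolding ell2_inner_def by (intro infsum_nonneg) auto

lemma ell2_inner_add_left:
  assumes "a \<in> ell2 S" "b \<in> ell2 S" "c \<in> ell2 S"
  shows "ell2_inner S (\<lambda>e. a e + b e) c = ell2_inner S a c + ell2_inner S b c"
  unfolding ell2_inner_def using assms
  by (simp add: distrib_right infsum_add ell2_mult_summable)

lemma ell2_inner_scale_left: "ell2_inner S (\<lambda>e. t * a e) c = t * ell2_inner S a c"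
  unfolding ell2_inner_def by (simp add: mult.assoc infsum_cmult_right')

lemma ell2_inner_scale_self:
  "ell2_inner S (\<lambda>e. t * a e) (\<lambda>e. t * a e) = t\<^sup>2 * ell2_inner S a a"
  by (subst ell2_inner_scale_left, subst ell2_inner_commute, subst ell2_inner_scale_left)
    (simp add: power2_eq_square)

lemma ell2_inner_diff_left:
  assumes "a \<in> ell2 S" "b \<in> ell2 S" "c \<in> ell2 S"
  shows "ell2_inner S (\<lambda>e. a e - b e) c = ell2_inner S a c - ell2_inner S b c"
  using ell2_inner_add_left[OF assms(1) ell2_scale[OF assms(2), of "-1"] assms(3)]
  by (simp add: ell2_inner_scale_left[of S "-1", simplified])

text \<open>The squared norm along a line, as the quadratic in \<open>t\<close> that
  \<open>discriminant_le\<close> expects; \<open>t = 1\<close> and \<open>t = -1\<close> together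
  give the parallelogram law.\<close>

lemma ell2_inner_self_add_scale:
  assumes "a \<in> ell2 S" "b \<in> ell2 S"
  shows "ell2_inner S (\<lambda>e. a e + t * b e) (\<lambda>e. a e + t * b e)
       = ell2_inner S a a + 2 * t * ell2_inner S a b + t\<^sup>2 * ell2_inner S b b"
proof -
  note tb = ell2_scale[OF assms(2), of t]
  note s = ell2_add[OF assms(1) tb]
  have left: "ell2_inner S (\<lambda>e. a e + t * b e) x = ell2_inner S a x + t * ell2_inner S b x"
    if "x \<in> ell2 S" for x
    unfolding ell2_inner_add_left[OF assms(1) tb that] ell2_inner_scale_left ..
  have right: "ell2_inner S x (\<lambda>e. a e + t * b e) = ell2_inner S a x + t * ell2_inner S b x"
    if "x \<in> ell2 S" for x
    using left[OF that] by (metis ell2_inner_commute)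
  show ?thesis
    unfolding left[OF s] right[OF assms(1)] right[OF assms(2)]
    unfolding ell2_inner_commute[of S b a] by (simp add: algebra_simps power2_eq_square)
qed

lemma ell2_Cauchy_Schwarz:
  assumes "a \<in> ell2 S" "b \<in> ell2 S"
  shows "(ell2_inner S a b)\<^sup>2 \<le> ell2_inner S a a * ell2_inner S b b"
proof (rule discriminant_le)
  show "0 \<le> ell2_inner S a a + 2 * t * ell2_inner S a b + t\<^sup>2 * ell2_inner S b b" for t
    unfolding ell2_inner_self_add_scale[OF assms, symmetric] by (rule ell2_inner_self_nonneg)
qed

section \<open>Convergence, completeness and projection in \<open>ell2\<close>\<close>

lemma ell2_inner_tendsto:
  assumes "\<And>n. a n \<in> ell2 S" "l \<in> ell2 S" "b \<in> ell2 S"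
    and "(\<lambda>n. ell2_inner S (\<lambda>e. a n e - l e) (\<lambda>e. a n e - l e)) \<longlonglongrightarrow> 0"
  shows "(\<lambda>n. ell2_inner S (a n) b) \<longlonglongrightarrow> ell2_inner S l b"
proof -
  have "(\<lambda>n. (ell2_inner S (\<lambda>e. a n e - l e) b)\<^sup>2) \<longlonglongrightarrow> 0"
  proof (rule tendsto_sandwich[OF always_eventually always_eventually tendsto_const])
    show "(\<lambda>n. ell2_inner S (\<lambda>e. a n e - l e) (\<lambda>e. a n e - l e) * ell2_inner S b b) \<longlonglongrightarrow> 0"
      using tendsto_mult_left_zero[OF assms(4)] .
  qed (use assms in \<open>auto intro!: ell2_Cauchy_Schwarz ell2_diff\<close>)
  then have "(\<lambda>n. ell2_inner S (\<lambda>e. a n e - l e) b) \<longlonglongrightarrow> 0" by simp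
  then have "(\<lambda>n. ell2_inner S (a n) b - ell2_inner S l b) \<longlonglongrightarrow> 0"
    using assms by (simp add: ell2_inner_diff_left)
  then show ?thesis by (rule LIM_zero_cancel)
qed

lemma sum_sq_le_ell2_inner:
  assumes "a \<in> ell2 S" "finite T" "T \<subseteq> S"
  shows "(\<Sum>e\<in>T. (a e)\<^sup>2) \<le> ell2_inner S a a"
  using finite_sum_le_infsum[OF ell2_mult_summable[OF assms(1,1)] assms(2,3)]
  unfolding ell2_inner_def by (simp add: power2_eq_square)

lemma ell2_tendsto_pointwise:
  assumes "\<And>n. a n \<in> ell2 S" "l \<in> ell2 S" "e \<in> S"
    and "(\<lambda>n. ell2_inner S (\<lambda>e. a n e - l e) (\<lambda>e. a n e - l e)) \<longlonglongrightarrow> 0"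
  shows "(\<lambda>n. a n e) \<longlonglongrightarrow> l e"
proof -
  have le: "(a n e - l e)\<^sup>2 \<le> ell2_inner S (\<lambda>e. a n e - l e) (\<lambda>e. a n e - l e)" for n
    using sum_sq_le_ell2_inner[OF ell2_diff[OF assms(1,2)], of "{e}"] assms(3) by simp
  have "(\<lambda>n. (a n e - l e)\<^sup>2) \<longlonglongrightarrow> 0"
    by (rule tendsto_sandwich[OF always_eventually always_eventually tendsto_const assms(4)])
      (simp_all add: le)
  then have "(\<lambda>n. a n e - l e) \<longlonglongrightarrow> 0" by simp
  then show ?thesis by (rule LIM_zero_cancel)
qed

text \<open>Uniform bounds on finite partial sums survive pointwise limits, so this is the criterion
  to apply to a limit function.\<close>

lemma ell2I_bounded:
  assumes "\<And>T. finite T \<Longrightarrow> T \<subseteq> S \<Longrightarrow> (\<Sum>e\<in>T. (a e)\<^sup>2) \<le> C"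
  shows "a \<in> ell2 S" "ell2_inner S a a \<le> C"
proof -
  have s: "(\<lambda>e. (a e)\<^sup>2) summable_on S"
    by (rule nonneg_bdd_above_summable_on) (use assms in \<open>auto intro!: bdd_aboveI2\<close>)
  then show "a \<in> ell2 S" by (simp add: ell2_def)
  show "ell2_inner S a a \<le> C"
    unfolding ell2_inner_def using s assms
    by (intro infsum_le_finite_sums) (auto simp: power2_eq_square)
qed

text \<open>Riesz-Fischer: the limit is taken coordinatewise, and the Cauchy estimate passes to it
  over finite sets of coordinates.\<close>

lemma ell2_complete:
  assumes a: "\<And>n. a n \<in> ell2 S"
    and C: "\<And>\<epsilon>. \<epsilon> > 0 \<Longrightarrow> \<exists>M. \<forall>m\<ge>M. \<forall>n\<ge>M.
              ell2_inner S (\<lambda>e. a m e - a n e) (\<lambda>e. a m e - a n e) \<le> \<epsilon>"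
  obtains l where "l \<in> ell2 S"
    "(\<lambda>n. ell2_inner S (\<lambda>e. a n e - l e) (\<lambda>e. a n e - l e)) \<longlonglongrightarrow> 0"
proof -
  \<comment> \<open>Off \<open>S\<close> this may be an unspecified value, which no inner product
    over \<open>S\<close> sees.\<close>
  define l where "l e = lim (\<lambda>n. a n e)" for e
  have "Cauchy (\<lambda>n. a n e)" if "e \<in> S" for e
  proof (rule metric_CauchyI)
    fix \<epsilon> :: real assume "\<epsilon> > 0"
    then obtain M where M: "\<And>m n. m \<ge> M \<Longrightarrow> n \<ge> M \<Longrightarrow>
        ell2_inner S (\<lambda>e. a m e - a n e) (\<lambda>e. a m e - a n e) \<le> (\<epsilon> / 2)\<^sup>2"
      using C[of "(\<epsilon> / 2)\<^sup>2"] by auto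
    have "dist (a m e) (a n e) < \<epsilon>" if "m \<ge> M" "n \<ge> M" for m n
    proof -
      have "(a m e - a n e)\<^sup>2 \<le> (\<epsilon> / 2)\<^sup>2"
        using sum_sq_le_ell2_inner[OF ell2_diff[OF a[of m] a[of n]], of "{e}"] M[OF that] \<open>e \<in> S\<close>
        by simp
      then have "\<bar>a m e - a n e\<bar> \<le> \<epsilon> / 2"
        using abs_le_square_iff[of "a m e - a n e" "\<epsilon> / 2"] \<open>\<epsilon> > 0\<close> by simp
      then show ?thesis using \<open>\<epsilon> > 0\<close> by (simp add: dist_real_def)
    qed
    then show "\<exists>M. \<forall>m\<ge>M. \<forall>n\<ge>M. dist (a m e) (a n e) < \<epsilon>" by blast
  qed
  then have l: "(\<lambda>n. a n e) \<longlonglongrightarrow> l e" if "e \<in> S" for e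
    using that unfolding l_def by (simp add: Cauchy_convergent_iff convergent_LIMSEQ_iff)
  have close: "\<exists>M. \<forall>m\<ge>M. (\<lambda>e. a m e - l e) \<in> ell2 S \<and>
      ell2_inner S (\<lambda>e. a m e - l e) (\<lambda>e. a m e - l e) \<le> \<epsilon>" if "\<epsilon> > 0" for \<epsilon>
  proof -
    obtain M where M: "\<And>m n. m \<ge> M \<Longrightarrow> n \<ge> M \<Longrightarrow>
        ell2_inner S (\<lambda>e. a m e - a n e) (\<lambda>e. a m e - a n e) \<le> \<epsilon>"
      using C[OF \<open>\<epsilon> > 0\<close>] by auto
    \<comment> \<open>Fatou-type step: \<open>m\<close> and the finite set \<open>T\<close> are
      fixed while \<open>n\<close> tends to infinity.\<close>
    have "(\<Sum>e\<in>T. (a m e - l e)\<^sup>2) \<le> \<epsilon>" if "m \<ge> M" "finite T" "T \<subseteq> S" for m T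
    proof (rule LIMSEQ_le_const2)
      show "(\<lambda>n. \<Sum>e\<in>T. (a m e - a n e)\<^sup>2) \<longlonglongrightarrow> (\<Sum>e\<in>T. (a m e - l e)\<^sup>2)"
        using l \<open>T \<subseteq> S\<close> by (intro tendsto_intros) auto
      show "\<exists>k. \<forall>n\<ge>k. (\<Sum>e\<in>T. (a m e - a n e)\<^sup>2) \<le> \<epsilon>"
        using order_trans[OF sum_sq_le_ell2_inner[OF ell2_diff[OF a a] that(2,3)] M[OF that(1)]]
        by blast
    qed
    then show ?thesis by (intro exI[of _ M] allI impI conjI ell2I_bounded)
  qed
  obtain m where "(\<lambda>e. a m e - l e) \<in> ell2 S" using close[of 1] by auto
  from ell2_diff[OF a[of m] this] have "l \<in> ell2 S" by simp
  moreover have "(\<lambda>n. ell2_inner S (\<lambda>e. a n e - l e) (\<lambda>e. a n e - l e)) \<longlonglongrightarrow> 0"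
  proof (rule LIMSEQ_I)
    fix r :: real assume "r > 0"
    then obtain M where "\<And>m. m \<ge> M \<Longrightarrow>
        ell2_inner S (\<lambda>e. a m e - l e) (\<lambda>e. a m e - l e) \<le> r / 2"
      using close[of "r / 2"] by auto
    then show "\<exists>M. \<forall>n\<ge>M. norm (ell2_inner S (\<lambda>e. a n e - l e) (\<lambda>e. a n e - l e) - 0) < r"
      using \<open>r > 0\<close> by (fastforce simp: ell2_inner_self_nonneg intro!: exI[of _ M])
  qed
  ultimately show ?thesis by (rule that)
qed

text \<open>\<open>V\<close> is a subspace that need not be closed, so the nearest point is replaced
  by a minimizing sequence \<open>v n\<close>. The limit \<open>l\<close> is the component of
  \<open>f\<close> orthogonal to the closure of \<open>V\<close>.\<close>

lemma ell2_projection: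
  assumes f: "f \<in> ell2 S" and VS: "V \<subseteq> ell2 S" and ne: "(\<lambda>_. 0) \<in> V"
    and add: "\<And>u v t. u \<in> V \<Longrightarrow> v \<in> V \<Longrightarrow> (\<lambda>e. u e + t * v e) \<in> V"
  obtains v l where "\<And>n. v n \<in> V" "l \<in> ell2 S"
    "(\<lambda>n. ell2_inner S (\<lambda>e. f e + v n e - l e) (\<lambda>e. f e + v n e - l e)) \<longlonglongrightarrow> 0"
    "\<And>u. u \<in> V \<Longrightarrow> ell2_inner S l u = 0"
proof -
  define q where "q v = ell2_inner S (\<lambda>e. f e + v e) (\<lambda>e. f e + v e)" for v
  define m where "m = Inf (q ` V)"
  have fv: "(\<lambda>e. f e + v e) \<in> ell2 S" if "v \<in> V" for v
    using that VS f ell2_add by blast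
  have bdd: "bdd_below (q ` V)"
    by (auto simp: q_def ell2_inner_self_nonneg intro!: bdd_belowI2[of _ 0])
  then have m_le: "m \<le> q v" if "v \<in> V" for v
    unfolding m_def using that by (simp add: cINF_lower)
  have "\<exists>v\<in>V. q v < m + 1 / Suc n" for n
    using cInf_lessD[of "q ` V" "m + 1 / Suc n"] ne unfolding m_def by auto
  then obtain v where v: "\<And>n. v n \<in> V" "\<And>n. q (v n) < m + 1 / Suc n" by metis
  \<comment> \<open>Moving from \<open>v n\<close> to \<open>v n + t * u\<close> cannot push the
    squared norm below the infimum \<open>m\<close>. The resulting quadratic in \<open>t\<close> is
    nonnegative, which bounds the inner product with \<open>u\<close>.\<close>
  have orth: "(ell2_inner S (\<lambda>e. f e + v n e) u)\<^sup>2 \<le> 1 / Suc n * ell2_inner S u u"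
    if "u \<in> V" for u n
  proof -
    have "(ell2_inner S (\<lambda>e. f e + v n e) u)\<^sup>2 \<le> (q (v n) - m) * ell2_inner S u u"
    proof (rule discriminant_le)
      fix t
      have "u \<in> ell2 S" using VS that by blast
      from ell2_inner_self_add_scale[OF fv[OF v(1)] this, of n t] m_le[OF add[OF v(1) that], of n t]
      show "0 \<le> q (v n) - m + 2 * t * ell2_inner S (\<lambda>e. f e + v n e) u + t\<^sup>2 * ell2_inner S u u"
        by (simp add: q_def add.assoc)
    qed
    also have "\<dots> \<le> 1 / Suc n * ell2_inner S u u"
      using v(2)[of n] by (intro mult_right_mono) (auto simp: ell2_inner_self_nonneg)
    finally show ?thesis .
  qed
  have dist: "ell2_inner S (\<lambda>e. (f e + v k e) - (f e + v n e)) (\<lambda>e. (f e + v k e) - (f e + v n e))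
      \<le> 2 * (1 / Suc k + 1 / Suc n)" for k n
  proof -
    let ?a = "\<lambda>e. f e + v k e" and ?b = "\<lambda>e. f e + v n e"
    \<comment> \<open>The midpoint of \<open>v k\<close> and \<open>v n\<close>, built from the one
      closure rule for \<open>V\<close>. Its squared norm is at least \<open>m\<close>, so the
      parallelogram law makes the sequence Cauchy. The factor 1 below matches the shape of
      \<open>ell2_inner_self_add_scale\<close>.\<close>
    have "(\<lambda>e. (v k e + (-1/2) * v k e) + (1/2) * v n e) \<in> V"
      using add v(1) by (intro add) auto
    from m_le[OF this] have "m \<le> ell2_inner S (\<lambda>e. 1/2 * (?a e + 1 * ?b e)) (\<lambda>e. 1/2 * (?a e + 1 * ?b e))"
      by (simp add: q_def algebra_simps)
    also have "\<dots> = 1/4 * ell2_inner S (\<lambda>e. ?a e + 1 * ?b e) (\<lambda>e. ?a e + 1 * ?b e)"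
      unfolding ell2_inner_scale_self by (simp add: power2_eq_square)
    finally have "4 * m \<le> q (v k) + 2 * ell2_inner S ?a ?b + q (v n)"
      unfolding ell2_inner_self_add_scale[OF fv[OF v(1)] fv[OF v(1)]] q_def by simp
    moreover have "ell2_inner S (\<lambda>e. ?a e - ?b e) (\<lambda>e. ?a e - ?b e)
        = q (v k) - 2 * ell2_inner S ?a ?b + q (v n)"
      using ell2_inner_self_add_scale[OF fv[OF v(1)] fv[OF v(1)], of k "-1" n] 
      by (simp add: q_def)
    ultimately show ?thesis using v(2)[of k] v(2)[of n] by simp
  qed
  have "\<exists>M. \<forall>k\<ge>M. \<forall>n\<ge>M. ell2_inner S (\<lambda>e. (f e + v k e) - (f e + v n e))
      (\<lambda>e. (f e + v k e) - (f e + v n e)) \<le> \<epsilon>" if pos: "\<epsilon> > 0" for \<epsilon> :: real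
  proof -
    obtain M where M: "1 / real (Suc M) < \<epsilon> / 4"
      by (rule nat_approx_posE[of "\<epsilon> / 4"]) (use pos in auto)
    have "1 / real (Suc n) < \<epsilon> / 4" if "n \<ge> M" for n
      using order.strict_trans1[OF _ M, of "1 / real (Suc n)"] that by (simp add: frac_le)
    then have "2 * (1 / real (Suc k) + 1 / real (Suc n)) \<le> 2 * (\<epsilon> / 4 + \<epsilon> / 4)"
      if "k \<ge> M" "n \<ge> M" for k n
      using that by (intro mult_left_mono add_mono less_imp_le) auto
    then have "2 * (1 / real (Suc k) + 1 / real (Suc n)) \<le> \<epsilon>" if "k \<ge> M" "n \<ge> M" for k n
      using that by simp
    then show ?thesis using order_trans[OF dist] by blast
  qed
  then obtain l where l: "l \<in> ell2 S"
    "(\<lambda>n. ell2_inner S (\<lambda>e. f e + v n e - l e) (\<lambda>e. f e + v n e - l e)) \<longlonglongrightarrow> 0"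
    using ell2_complete[of "\<lambda>n e. f e + v n e" S] fv v(1) by blast
  have "ell2_inner S l u = 0" if "u \<in> V" for u
  proof -
    have "u \<in> ell2 S" using VS that by blast
    from ell2_inner_tendsto[OF fv[OF v(1)] l(1) this l(2)]
    have 1: "(\<lambda>n. (ell2_inner S (\<lambda>e. f e + v n e) u)\<^sup>2) \<longlonglongrightarrow> (ell2_inner S l u)\<^sup>2"
      by (rule tendsto_power)
    have "(\<lambda>n. 1 / real (Suc n) * ell2_inner S u u) \<longlonglongrightarrow> 0"
      by (intro tendsto_mult_left_zero) (rule LIMSEQ_Suc[OF lim_1_over_n])
    then have "(\<lambda>n. (ell2_inner S (\<lambda>e. f e + v n e) u)\<^sup>2) \<longlonglongrightarrow> 0"
      by (rule tendsto_sandwich[rotated 3]) (use orth[OF that] in auto)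
    with 1 show ?thesis using LIMSEQ_unique by fastforce
  qed
  with v(1) l show ?thesis by (rule that)
qed

subsection \<open>Gradients and flows\<close>

lemma nonloopsE:
  assumes "e \<in> nonloops N"
  obtains x y where "e \<in> edges N" "ends N e = {x, y}" "x \<noteq> y"
  using assms unfolding nonloops_def by (auto simp: card_2_iff)

lemma dedges_iff: "(e, x, y) \<in> dedges N \<longleftrightarrow> e \<in> edges N \<and> ends N e = {x, y} \<and> x \<noteq> y"
  by (auto simp: dedges_def)

lemma dedges_rev: "(e, x, y) \<in> dedges N \<longleftrightarrow> (e, y, x) \<in> dedges N"
  by (auto simp: dedges_iff)

lemma dedges_nonloops: "(e, x, y) \<in> dedges N \<Longrightarrow> e \<in> nonloops N"
  by (auto simp: dedges_iff nonloops_def)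

text \<open>One admissible orientation shows that the choice is well defined; the set of ends then
  leaves only two candidates.\<close>

lemma orient_cases:
  assumes "(e, x, y) \<in> dedges N"
  shows "orient N e = (e, x, y) \<or> orient N e = (e, y, x)"
proof -
  have "orient N e \<in> dedges N \<and> edge_of (orient N e) = e"
    unfolding orient_def by (rule someI[of _ "(e, x, y)"]) (use assms in \<open>simp add: edge_of_def\<close>)
  with assms show ?thesis
    by (cases "orient N e") (auto simp: dedges_iff edge_of_def doubleton_eq_iff)
qed

lemma orientE:
  assumes "e \<in> nonloops N"
  obtains x y where "orient N e = (e, x, y)" "(e, x, y) \<in> dedges N"
proof -
  obtain x y where "e \<in> edges N" "ends N e = {x, y}" "x \<noteq> y" using assms by (rule nonloopsE)
  then have "(e, x, y) \<in> dedges N" "(e, y, x) \<in> dedges N" by (auto simp: dedges_iff)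
  with orient_cases[of e x y N] that show ?thesis by blast
qed

lemma dedges_verts:
  assumes "is_network N" "(e, x, y) \<in> dedges N"
  shows "x \<in> verts N" "y \<in> verts N" "res N e > 0"
  using assms by (auto simp: dedges_iff is_network_def)

lemma res_pos_nonloops: "is_network N \<Longrightarrow> e \<in> nonloops N \<Longrightarrow> res N e > 0"
  by (auto simp: nonloops_def is_network_def)

text \<open>The bracket is the coboundary of the indicator of \<open>x\<close>. It vanishes off the
  finitely many edges at \<open>x\<close>, and there its sign converts the chosen orientation into
  the one leaving \<open>x\<close>, by antisymmetry.\<close>

lemma has_sum_coboundary_point:
  assumes lf: "locally_finite N" and anti: "antisymmetric N \<theta>" and x: "x \<in> verts N"
  shows "((\<lambda>e. \<theta> (orient N e) *
            (of_bool (init (orient N e) = x) - of_bool (ter (orient N e) = x)))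
          has_sum (\<Sum>d | d \<in> dedges N \<and> init d = x. \<theta> d)) (nonloops N)"
    (is "(?t has_sum sum \<theta> ?D) _")
proof (rule has_sum_finite_neutralI)
  \<comment> \<open>With the initial vertex fixed, an edge determines its other end, so parallel
    edges cause no collision.\<close>
  have inj: "inj_on edge_of ?D"
    by (auto simp: inj_on_def dedges_def edge_of_def init_def doubleton_eq_iff)
  have "edge_of ` ?D \<subseteq> {e \<in> edges N. x \<in> ends N e}"
    by (auto simp: dedges_def edge_of_def init_def)
  then show "finite (edge_of ` ?D)"
    using lf x by (auto simp: locally_finite_def intro: finite_subset)
  show "edge_of ` ?D \<subseteq> nonloops N"
    by (auto simp: edge_of_def intro: dedges_nonloops)
  show "?t e = 0" if "e \<in> nonloops N - edge_of ` ?D" for e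
  proof -
    from that obtain y z where yz: "orient N e = (e, y, z)" "(e, y, z) \<in> dedges N"
      by (auto elim: orientE)
    then have "(e, z, y) \<in> dedges N" by (auto simp: dedges_iff)
    with that yz have "y \<noteq> x" "z \<noteq> x"
      by (force simp: edge_of_def init_def image_iff)+
    with yz show ?thesis by (simp add: init_def ter_def)
  qed
  have "sum ?t (edge_of ` ?D) = (\<Sum>d\<in>?D. ?t (edge_of d))"
    by (rule sum.reindex[OF inj, simplified comp_def])
  also have "\<dots> = sum \<theta> ?D"
  proof (rule sum.cong[OF refl])
    fix d assume "d \<in> ?D"
    then obtain e y where d: "d = (e, x, y)" "(e, x, y) \<in> dedges N"
      by (cases d) (auto simp: init_def)
    then have "x \<noteq> y" by (simp add: dedges_iff)
    moreover have "\<theta> (e, x, y) = - \<theta> (e, y, x)"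
      using anti d(2) by (auto simp: antisymmetric_def)
    ultimately show "?t (edge_of d) = \<theta> d"
      using orient_cases[OF d(2)] unfolding d(1)
      by (elim disjE) (simp_all add: edge_of_def init_def ter_def)
  qed
  finally show "sum \<theta> ?D = sum ?t (edge_of ` ?D)" by simp
qed

lemma has_sum_sum_finite:
  fixes f :: "'i \<Rightarrow> 'a \<Rightarrow> real"
  assumes "finite F" "\<And>i. i \<in> F \<Longrightarrow> (f i has_sum s i) A"
  shows "((\<lambda>x. \<Sum>i\<in>F. f i x) has_sum (\<Sum>i\<in>F. s i)) A"
  using assms by (induction F rule: finite_induct) (auto intro: has_sum_add)

text \<open>Discrete Green identity: \<open>g\<close> is a finite combination of indicators of
  points, so the one-point case extends by linearity.\<close>

lemma has_sum_coboundary: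
  assumes "locally_finite N" "antisymmetric N \<theta>"
    and F: "finite F" "F \<subseteq> verts N" "\<And>z. z \<notin> F \<Longrightarrow> g z = 0"
  shows "((\<lambda>e. \<theta> (orient N e) * (g (init (orient N e)) - g (ter (orient N e))))
          has_sum (\<Sum>x\<in>F. g x * (\<Sum>d | d \<in> dedges N \<and> init d = x. \<theta> d))) (nonloops N)"
proof -
  have g: "(\<Sum>x\<in>F. g x * of_bool (z = x)) = g z" for z
    using F by (cases "z \<in> F") (auto simp: of_bool_def if_distrib sum.delta cong: if_cong)
  have "((\<lambda>e. \<Sum>x\<in>F. g x * (\<theta> (orient N e) *
            (of_bool (init (orient N e) = x) - of_bool (ter (orient N e) = x))))
          has_sum (\<Sum>x\<in>F. g x * (\<Sum>d | d \<in> dedges N \<and> init d = x. \<theta> d))) (nonloops N)"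
    using assms by (intro has_sum_sum_finite has_sum_cmult_right has_sum_coboundary_point) auto
  also have "(\<lambda>e. \<Sum>x\<in>F. g x * (\<theta> (orient N e) *
            (of_bool (init (orient N e) = x) - of_bool (ter (orient N e) = x))))
      = (\<lambda>e. \<theta> (orient N e) * (g (init (orient N e)) - g (ter (orient N e))))"
  proof (rule ext)
    fix e
    have "g (init (orient N e)) - g (ter (orient N e))
        = (\<Sum>x\<in>F. g x * (of_bool (init (orient N e) = x) - of_bool (ter (orient N e) = x)))"
      unfolding right_diff_distrib sum_subtractf g ..
    then show "(\<Sum>x\<in>F. g x * (\<theta> (orient N e) *
            (of_bool (init (orient N e) = x) - of_bool (ter (orient N e) = x))))
        = \<theta> (orient N e) * (g (init (orient N e)) - g (ter (orient N e)))"
      by (simp only: sum_distrib_left mult.left_commute)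
  qed
  finally show ?thesis .
qed

text \<open>Flows are measured by incoming sums and Green's identity by outgoing ones; reversing
  every edge costs a sign.\<close>

lemma accumulation_eq_init:
  assumes "antisymmetric N \<theta>"
  shows "accumulation N \<theta> x = - (\<Sum>d | d \<in> dedges N \<and> init d = x. \<theta> d)"
proof -
  have "accumulation N \<theta> x = (\<Sum>d | d \<in> dedges N \<and> init d = x. - \<theta> d)"
    unfolding accumulation_def
    by (rule sum.reindex_bij_witness[where i = "\<lambda>(e, x, y). (e, y, x)" and j = "\<lambda>(e, x, y). (e, y, x)"])
      (use assms in \<open>auto simp: dedges_def init_def ter_def antisymmetric_def\<close>)
  then show ?thesis by (simp add: sum_negf)
qed

text \<open>Scaled so that the energy of a potential is the square of the \<open>\<ell>\<^sup>2\<close>-norm of its gradient.\<close>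

definition grad :: "('v, 'e) network \<Rightarrow> ('v \<Rightarrow> real) \<Rightarrow> 'e \<Rightarrow> real" where
  "grad N h e = (h (init (orient N e)) - h (ter (orient N e))) / sqrt (res N e)"

lemma grad_add: "grad N (\<lambda>x. g x + t * h x) = (\<lambda>e. grad N g e + t * grad N h e)"
  by (rule ext) (simp add: grad_def field_simps diff_divide_distrib add_divide_distrib)

lemma finite_potential_energy_iff_grad:
  assumes "is_network N"
  shows "finite_potential_energy N h \<longleftrightarrow> grad N h \<in> ell2 (nonloops N)"
  unfolding finite_potential_energy_def ell2_def grad_def mem_Collect_eq
  by (rule summable_on_cong) (use res_pos_nonloops[OF assms] in \<open>simp add: power_divide less_imp_le\<close>)

text \<open>Only the finitely many edges meeting \<open>F\<close> can carry a nonzero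
  gradient.\<close>

lemma grad_finite_support:
  assumes "locally_finite N" "finite F" "F \<subseteq> verts N" "\<And>z. z \<notin> F \<Longrightarrow> g z = 0"
  shows "grad N g \<in> ell2 (nonloops N)"
  unfolding ell2_def mem_Collect_eq
proof (rule finite_nonzero_values_imp_summable_on, rule finite_subset)
  show "finite (\<Union>x\<in>F. {e \<in> edges N. x \<in> ends N e})"
    using assms unfolding locally_finite_def by blast
  show "{e \<in> nonloops N. (grad N g e)\<^sup>2 \<noteq> 0} \<subseteq> (\<Union>x\<in>F. {e \<in> edges N. x \<in> ends N e})"
  proof
    fix e assume e: "e \<in> {e \<in> nonloops N. (grad N g e)\<^sup>2 \<noteq> 0}"
    then obtain x y where xy: "orient N e = (e, x, y)" "(e, x, y) \<in> dedges N"
      by (auto elim: orientE)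
    with e have "g x \<noteq> 0 \<or> g y \<noteq> 0" by (auto simp: grad_def init_def ter_def)
    with assms(4) have "x \<in> F \<or> y \<in> F" by blast
    with xy show "e \<in> (\<Union>x\<in>F. {e \<in> edges N. x \<in> ends N e})" by (auto simp: dedges_iff)
  qed
qed

text \<open>By Green's identity, orthogonality to the gradient of the indicator of \<open>x\<close>
  is the weighted mean value property at \<open>x\<close>.\<close>

lemma harmonicI:
  assumes N: "is_network N" "locally_finite N"
    and orth: "\<And>x. x \<in> verts N \<Longrightarrow>
      ell2_inner (nonloops N) (grad N h) (grad N (\<lambda>z. of_bool (z = x))) = 0"
  shows "harmonic N h"
  unfolding harmonic_def
proof
  fix x assume x: "x \<in> verts N"
  \<comment> \<open>The current induced by \<open>h\<close> through Ohm's law; the two square roots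
    in the gradients combine to the conductance.\<close>
  define \<theta> where "\<theta> d = cond N (edge_of d) * (h (init d) - h (ter d))" for d
  have anti: "antisymmetric N \<theta>"
    by (auto simp: antisymmetric_def \<theta>_def edge_of_def init_def ter_def algebra_simps)
  have "ell2_inner (nonloops N) (grad N h) (grad N (\<lambda>z. of_bool (z = x)))
      = (\<Sum>\<^sub>\<infinity>e\<in>nonloops N. \<theta> (orient N e) *
            (of_bool (init (orient N e) = x) - of_bool (ter (orient N e) = x)))"
    unfolding ell2_inner_def
  proof (rule infsum_cong)
    fix e assume e: "e \<in> nonloops N"
    then have "edge_of (orient N e) = e" by (auto simp: edge_of_def elim: orientE)
    then show "grad N h e * grad N (\<lambda>z. of_bool (z = x)) e = \<theta> (orient N e) *
            (of_bool (init (orient N e) = x) - of_bool (ter (orient N e) = x))"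
      using res_pos_nonloops[OF N(1) e] by (simp add: grad_def \<theta>_def cond_def)
  qed
  also have "\<dots> = (\<Sum>d | d \<in> dedges N \<and> init d = x. \<theta> d)"
    by (rule infsumI[OF has_sum_coboundary_point[OF N(2) anti x]])
  finally show "(\<Sum>d | d \<in> dedges N \<and> init d = x. cond N (edge_of d) * (h x - h (ter d))) = 0"
    unfolding orth[OF x] \<theta>_def by (simp cong: sum.cong_simp)
qed

section \<open>Subnetworks and flows of transient networks\<close>

lemma orient_subnetwork:
  assumes "subnetwork H N" "e \<in> edges H"
  shows "orient H e = orient N e"
proof -
  \<comment> \<open>The choice operator sees the same candidates in both networks, so the picks
    agree exactly and not merely up to reversal.\<close>
  have "d \<in> dedges H \<and> edge_of d = e \<longleftrightarrow> d \<in> dedges N \<and> edge_of d = e" for d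
    using assms by (cases d) (auto simp: dedges_iff edge_of_def subnetwork_def)
  then show ?thesis unfolding orient_def by simp
qed

lemma subnetwork_trans: "subnetwork H K \<Longrightarrow> subnetwork K N \<Longrightarrow> subnetwork H N"
  by (auto simp: subnetwork_def)

text \<open>
  By Green's identity, pairing with a flow out of \<open>v\<close> evaluates finitely supported potentials at \<open>v\<close>,
  so in a transient network point evaluation is bounded in the energy norm.
\<close>

lemma transient_evaluation:
  assumes N: "is_network N" "locally_finite N" and H: "subnetwork H N" "transient H"
  obtains v b I where "v \<in> verts H" "I \<noteq> 0" "b \<in> ell2 (nonloops N)" "\<And>e. e \<notin> edges H \<Longrightarrow> b e = 0"
    "\<And>F g. finite F \<Longrightarrow> F \<subseteq> verts N \<Longrightarrow> (\<And>z. z \<notin> F \<Longrightarrow> g z = 0) \<Longrightarrow>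
       ell2_inner (nonloops N) (grad N g) b = I * g v"
proof -
  obtain v I \<phi> where v: "v \<in> verts H" "I \<noteq> 0" "is_flow H v I \<phi>" "finite_flow_energy H \<phi>"
    using H(2) unfolding transient_def by blast
  have sub: "dedges H \<subseteq> dedges N" "nonloops H \<subseteq> nonloops N" "edges H \<subseteq> edges N" "verts H \<subseteq> verts N"
    "ends H = ends N" "res H = res N" "is_network H"
    using H(1) by (auto simp: subnetwork_def dedges_def nonloops_def)
  \<comment> \<open>The flow is extended by zero to \<open>N\<close>. The factor in \<open>b\<close>
    makes its squared norm the flow energy and cancels the scaling of \<open>grad\<close> in the
    pairing.\<close>
  define \<psi> where "\<psi> d = (if d \<in> dedges H then \<phi> d else 0)" for d
  define b where "b e = \<psi> (orient N e) * sqrt (res N e)" for e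
  have anti: "antisymmetric N \<psi>"
  proof -
    have "\<psi> (e, x, y) = - \<psi> (e, y, x)" for e x y
    proof (cases "(e, x, y) \<in> dedges H")
      case True
      then have "\<phi> (e, x, y) = - \<phi> (e, y, x)"
        using v(3) unfolding is_flow_def antisymmetric_def by blast
      with True dedges_rev[of e x y H] show ?thesis unfolding \<psi>_def by simp
    next
      case False
      moreover from this have "(e, y, x) \<notin> dedges H" using dedges_rev[of e x y H] by blast
      ultimately show ?thesis unfolding \<psi>_def by simp
    qed
    then show ?thesis unfolding antisymmetric_def by blast
  qed
  have fin: "finite {d. d \<in> dedges N \<and> ter d = x}" if "x \<in> verts N" for x
  proof (rule finite_imageD)
    show "inj_on edge_of {d. d \<in> dedges N \<and> ter d = x}"
      by (auto simp: inj_on_def dedges_def edge_of_def ter_def doubleton_eq_iff)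
    have "edge_of ` {d. d \<in> dedges N \<and> ter d = x} \<subseteq> {e \<in> edges N. x \<in> ends N e}"
      by (auto simp: dedges_def edge_of_def ter_def)
    then show "finite (edge_of ` {d. d \<in> dedges N \<and> ter d = x})"
      using N(2) that by (auto simp: locally_finite_def intro: finite_subset)
  qed
  have acc: "accumulation N \<psi> x = (if x = v then I else 0)" if "x \<in> verts N" for x
  proof -
    have "accumulation N \<psi> x = accumulation H \<phi> x"
      unfolding accumulation_def
      by (rule sum.mono_neutral_cong_right) (use sub fin[OF that] in \<open>auto simp: \<psi>_def\<close>)
    moreover have "accumulation H \<phi> x = 0" if "x \<notin> verts H"
    proof -
      have "{d. d \<in> dedges H \<and> ter d = x} = {}"
        using that dedges_verts(2)[OF sub(7)] by (auto simp: ter_def)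
      then show ?thesis unfolding accumulation_def by (simp only: sum.empty)
    qed
    ultimately show ?thesis using v(1,3) by (auto simp: is_flow_def)
  qed
  have b0: "b e = 0" if "e \<in> nonloops N - nonloops H" for e
  proof -
    from that obtain x y where "orient N e = (e, x, y)" by (auto elim: orientE)
    with that have "orient N e \<notin> dedges H" by (auto intro: dedges_nonloops)
    then show ?thesis by (simp add: b_def \<psi>_def)
  qed
  \<comment> \<open>Off \<open>nonloops N\<close> the value of \<open>orient\<close> is an
    unspecified choice, so \<open>b\<close> might be nonzero there. Truncating makes the vanishing
    outside \<open>edges H\<close> literal.\<close>
  define b' where "b' e = (if e \<in> nonloops H then b e else 0)" for e
  have b'b: "b' e = b e" if "e \<in> nonloops N" for e
    using b0[of e] that by (auto simp: b'_def)
  have "b' \<in> ell2 (nonloops N)"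
  proof -
    have "(\<lambda>e. (b' e)\<^sup>2) summable_on nonloops N \<longleftrightarrow>
        (\<lambda>e. res H e * (\<phi> (orient H e))\<^sup>2) summable_on nonloops H"
    proof (rule summable_on_cong_neutral)
      fix e assume "e \<in> nonloops N \<inter> nonloops H"
      then have e: "e \<in> nonloops H" by simp
      then obtain x y where "orient H e = (e, x, y)" "(e, x, y) \<in> dedges H" by (rule orientE)
      moreover have "orient H e = orient N e"
        using e H(1) by (intro orient_subnetwork) (auto simp: nonloops_def)
      ultimately show "(b' e)\<^sup>2 = res H e * (\<phi> (orient H e))\<^sup>2"
        using e res_pos_nonloops[OF sub(7) e] sub(6)
        by (simp add: b'_def b_def \<psi>_def power_mult_distrib)
    qed (use sub in \<open>auto simp: b'_def\<close>)
    with v(4) show ?thesis by (simp add: ell2_def finite_flow_energy_def)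
  qed
  moreover have "ell2_inner (nonloops N) (grad N g) b' = - I * g v"
    if F: "finite F" "F \<subseteq> verts N" "\<And>z. z \<notin> F \<Longrightarrow> g z = 0" for F g
  proof -
    have "ell2_inner (nonloops N) (grad N g) b'
        = (\<Sum>\<^sub>\<infinity>e\<in>nonloops N. \<psi> (orient N e) * (g (init (orient N e)) - g (ter (orient N e))))"
      unfolding ell2_inner_def
    proof (rule infsum_cong)
      fix e assume "e \<in> nonloops N"
      then show "grad N g e * b' e = \<psi> (orient N e) * (g (init (orient N e)) - g (ter (orient N e)))"
        using res_pos_nonloops[OF N(1), of e] by (simp add: b'b b_def grad_def)
    qed
    also have "\<dots> = (\<Sum>x\<in>F. g x * (\<Sum>d | d \<in> dedges N \<and> init d = x. \<psi> d))"
      by (rule infsumI[OF has_sum_coboundary[OF N(2) anti F]])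
    also have "\<dots> = (\<Sum>x\<in>F. if x = v then - I * g v else 0)"
    proof (rule sum.cong[OF refl])
      fix x assume "x \<in> F"
      then have "- (\<Sum>d | d \<in> dedges N \<and> init d = x. \<psi> d) = (if x = v then I else 0)"
        unfolding accumulation_eq_init[OF anti, symmetric] using F(2) by (intro acc) blast
      from arg_cong[OF this, of uminus] have "(\<Sum>d | d \<in> dedges N \<and> init d = x. \<psi> d) = - (if x = v then I else 0)"
        by (simp only: minus_minus)
      then show "g x * (\<Sum>d | d \<in> dedges N \<and> init d = x. \<psi> d) = (if x = v then - I * g v else 0)"
        by simp
    qed
    also have "\<dots> = - I * g v" using F by (auto simp: sum.delta)
    finally show ?thesis .
  qed
  moreover have "b' e = 0" if "e \<notin> edges H" for e
    using that by (auto simp: b'_def nonloops_def)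
  \<comment> \<open>The sign of the intensity flips because Green's identity uses outgoing
    sums.\<close>
  ultimately show ?thesis using v(1,2) by (intro that[of v "- I" b']) auto
qed

subsection \<open>Royden decomposition of a separating potential\<close>

text \<open>The factor \<open>s\<close> depends on the edge and not on the potential, so convergence
  of gradients at an edge carries over to differences of values.\<close>

lemma adjacent_orient:
  assumes "is_network N" "adjacent N x y"
  obtains "x = y" | e s where "e \<in> nonloops N" "\<And>h. h y - h x = s * grad N h e"
proof (cases "x = y")
  case False
  obtain e where e: "e \<in> edges N" "ends N e = {x, y}"
    using assms(2) by (auto simp: adjacent_def)
  with False have d: "(e, x, y) \<in> dedges N" by (simp add: dedges_iff)
  define s where "s = (if orient N e = (e, x, y) then - sqrt (res N e) else sqrt (res N e))"
  have "h y - h x = s * grad N h e" for h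
    using orient_cases[OF d] dedges_verts(3)[OF assms(1) d] False
    by (auto simp: s_def grad_def init_def ter_def)
  with dedges_nonloops[OF d] show ?thesis by (rule that(2))
qed (rule that(1))

text \<open>The analytic half of the argument: cuts and components enter only through a potential of
  finite energy that is constant on each of two transient subnetworks.\<close>

lemma separating_potential_not_O_HD:
  assumes N: "is_network N" "net_connected N" "locally_finite N"
    and f: "finite_potential_energy N f"
    and H1: "subnetwork H1 N" "transient H1" "\<And>x. x \<in> verts H1 \<Longrightarrow> f x = c1"
    and H2: "subnetwork H2 N" "transient H2" "\<And>x. x \<in> verts H2 \<Longrightarrow> f x = c2"
    and "c1 \<noteq> c2"
  shows "N \<notin> O_HD"
proof
  assume O: "N \<in> O_HD"
  define S where "S = nonloops N"
  define fs where "fs = {g :: 'a \<Rightarrow> real. \<exists>F. finite F \<and> F \<subseteq> verts N \<and> (\<forall>z. z \<notin> F \<longrightarrow> g z = 0)}"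
  have f_ell2: "grad N f \<in> ell2 S"
    using f finite_potential_energy_iff_grad[OF N(1)] by (simp add: S_def)
  have fs_ell2: "grad N g \<in> ell2 S" if "g \<in> fs" for g
    using that grad_finite_support[OF N(3)] unfolding fs_def S_def by blast
  have fs_add: "(\<lambda>x. g x + t * k x) \<in> fs" if "g \<in> fs" "k \<in> fs" for g k t
  proof -
    from that obtain F K where "finite F" "F \<subseteq> verts N" "\<forall>z. z \<notin> F \<longrightarrow> g z = 0"
      "finite K" "K \<subseteq> verts N" "\<forall>z. z \<notin> K \<longrightarrow> k z = 0" unfolding fs_def by blast
    then show ?thesis unfolding fs_def by (intro CollectI exI[of _ "F \<union> K"]) auto
  qed
  have fs_point: "(\<lambda>z. of_bool (z = x)) \<in> fs" if "x \<in> verts N" for x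
    using that unfolding fs_def by (intro CollectI exI[of _ "{x}"]) auto
  have fs_zero: "(\<lambda>_. 0) \<in> fs" unfolding fs_def by blast
  obtain v l where v: "\<And>n. v n \<in> grad N ` fs" and l: "l \<in> ell2 S"
    and lim: "(\<lambda>n. ell2_inner S (\<lambda>e. grad N f e + v n e - l e) (\<lambda>e. grad N f e + v n e - l e)) \<longlonglongrightarrow> 0"
    and orth: "\<And>u. u \<in> grad N ` fs \<Longrightarrow> ell2_inner S l u = 0"
  proof (rule ell2_projection[OF f_ell2, of "grad N ` fs"])
    show "grad N ` fs \<subseteq> ell2 S" using fs_ell2 by blast
    have "(\<lambda>_. 0) = grad N (\<lambda>_. 0)" by (rule ext) (simp add: grad_def)
    then show "(\<lambda>_. 0) \<in> grad N ` fs" using fs_zero by blast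
    show "(\<lambda>e. u e + t * w e) \<in> grad N ` fs" if "u \<in> grad N ` fs" "w \<in> grad N ` fs" for u w t
      using that fs_add by (auto simp flip: grad_add)
  qed (use that in blast)
  have "\<forall>n. \<exists>g. g \<in> fs \<and> v n = grad N g" using v by blast
  then obtain g where g: "\<And>n. g n \<in> fs" "\<And>n. v n = grad N (g n)" by metis
  define h where "h n x = f x + g n x" for n x
  have grad_h: "grad N (h n) = (\<lambda>e. grad N f e + v n e)" for n
    using grad_add[of N f 1 "g n"] by (simp add: h_def[abs_def] g(2))
  have h_ell2: "grad N (h n) \<in> ell2 S" for n
    unfolding grad_h g(2) by (intro ell2_add f_ell2 fs_ell2 g(1))
  have h_lim: "(\<lambda>n. ell2_inner S (\<lambda>e. grad N (h n) e - l e) (\<lambda>e. grad N (h n) e - l e)) \<longlonglongrightarrow> 0"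
    using lim by (simp add: grad_h)
  have h_pt: "(\<lambda>n. grad N (h n) e) \<longlonglongrightarrow> l e" if "e \<in> S" for e
    by (rule ell2_tendsto_pointwise[OF h_ell2 l that h_lim])
  obtain w0 where w0: "w0 \<in> verts N" using N(2) by (auto simp: net_connected_def)
  \<comment> \<open>Gradients determine potentials only up to constants, so values are normalised at
    \<open>w0\<close>; convergence then propagates along paths.\<close>
  have conv: "convergent (\<lambda>n. h n x - h n w0)" if "x \<in> verts N" for x
  proof -
    have "(adjacent N)\<^sup>*\<^sup>* w0 x" using N(2) w0 that by (auto simp: net_connected_def)
    then show ?thesis
    proof (induction rule: rtranclp_induct)
      case (step y z)
      have "convergent (\<lambda>n. h n z - h n y)"
        using N(1) step.hyps(2)
      proof (rule adjacent_orient)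
        fix e s assume e: "e \<in> nonloops N" "\<And>h. h z - h y = s * grad N h e"
        then have "(\<lambda>n. h n z - h n y) \<longlonglongrightarrow> s * l e"
          using h_pt[of e] by (auto simp: S_def intro!: tendsto_intros)
        then show ?thesis by (auto simp: convergent_def)
      qed (simp add: convergent_const)
      from convergent_add[OF this step.IH] show ?case by simp
    qed (simp add: convergent_const)
  qed
  define k where "k x = lim (\<lambda>n. h n x - h n w0)" for x
  have k: "(\<lambda>n. h n x - h n w0) \<longlonglongrightarrow> k x" if "x \<in> verts N" for x
    using conv[OF that] by (simp add: k_def convergent_LIMSEQ_iff)
  have k_diff: "(\<lambda>n. h n x - h n y) \<longlonglongrightarrow> k x - k y" if "x \<in> verts N" "y \<in> verts N" for x y
    using tendsto_diff[OF k[OF that(1)] k[OF that(2)]] by simp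
  \<comment> \<open>The limit vector is again a gradient, so orthogonality of \<open>l\<close> can
    be read as harmonicity of \<open>k\<close>.\<close>
  have grad_k: "grad N k e = l e" if "e \<in> S" for e
  proof -
    obtain x y where xy: "orient N e = (e, x, y)" "(e, x, y) \<in> dedges N"
      using \<open>e \<in> S\<close> unfolding S_def by (rule orientE)
    have "(\<lambda>n. grad N (h n) e) \<longlonglongrightarrow> grad N k e"
      unfolding grad_def divide_inverse using k_diff dedges_verts(1,2)[OF N(1) xy(2)] xy(1)
      by (auto simp: init_def ter_def intro!: tendsto_mult_right)
    then show ?thesis using h_pt[OF that] by (rule LIMSEQ_unique)
  qed
  have inner_k: "ell2_inner S (grad N k) u = ell2_inner S l u" for u
    unfolding ell2_inner_def by (rule infsum_cong) (simp add: grad_k)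
  have "harmonic N k"
    using N(1,3)
  proof (rule harmonicI)
    fix x assume "x \<in> verts N"
    then show "ell2_inner (nonloops N) (grad N k) (grad N (\<lambda>z. of_bool (z = x))) = 0"
      using orth[OF imageI[OF fs_point]] inner_k unfolding S_def by simp
  qed
  moreover have "finite_potential_energy N k"
  proof -
    have "(\<lambda>e. (grad N k e)\<^sup>2) summable_on S \<longleftrightarrow> (\<lambda>e. (l e)\<^sup>2) summable_on S"
      by (rule summable_on_cong) (simp add: grad_k)
    with l show ?thesis
      unfolding finite_potential_energy_iff_grad[OF N(1)] by (simp add: ell2_def S_def)
  qed
  ultimately obtain c where c: "\<And>x. x \<in> verts N \<Longrightarrow> k x = c" using O unfolding O_HD_def by blast
  have l0: "l e = 0" if "e \<in> S" for e
  proof -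
    obtain x y where xy: "orient N e = (e, x, y)" "(e, x, y) \<in> dedges N"
      using \<open>e \<in> S\<close> unfolding S_def by (rule orientE)
    then have "grad N k e = 0"
      using c dedges_verts(1,2)[OF N(1) xy(2)] by (simp add: grad_def init_def ter_def)
    then show ?thesis using grad_k[OF that] by simp
  qed
  \<comment> \<open>Here \<open>h n\<close> is not normalised: the flow recovers its actual limit at
    the source \<open>p\<close>. The pairing with the gradient of \<open>h n\<close> equals
    \<open>I * g n p\<close> and tends to the pairing with \<open>l\<close>, which is 0.\<close>
  have key: "\<exists>p\<in>verts H. (\<lambda>n. h n p) \<longlonglongrightarrow> b"
    if H: "subnetwork H N" "transient H" "\<And>x. x \<in> verts H \<Longrightarrow> f x = b" for H b
    using N(1,3) H(1,2)
  proof (rule transient_evaluation)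
    fix p \<phi> I
    assume p: "p \<in> verts H" "I \<noteq> 0" and \<phi>: "\<phi> \<in> ell2 (nonloops N)" "\<And>e. e \<notin> edges H \<Longrightarrow> \<phi> e = 0"
      and ev: "\<And>F g. finite F \<Longrightarrow> F \<subseteq> verts N \<Longrightarrow> (\<And>z. z \<notin> F \<Longrightarrow> g z = 0) \<Longrightarrow>
        ell2_inner (nonloops N) (grad N g) \<phi> = I * g p"
    \<comment> \<open>Off \<open>H\<close> the flow vector vanishes; on edges of \<open>H\<close>
      the potential \<open>f\<close> is constant.\<close>
    have "grad N f e * \<phi> e = 0" if "e \<in> S" for e
    proof (cases "e \<in> edges H")
      case True
      obtain x y where xy: "orient N e = (e, x, y)" "(e, x, y) \<in> dedges N"
        using \<open>e \<in> S\<close> unfolding S_def by (rule orientE)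
      with True H(1) have "x \<in> verts H" "y \<in> verts H"
        by (auto simp: dedges_iff subnetwork_def is_network_def)
      with xy(1) H(3) show ?thesis by (simp add: grad_def init_def ter_def)
    qed (simp add: \<phi>(2))
    then have f0: "ell2_inner S (grad N f) \<phi> = 0"
      unfolding ell2_inner_def by (rule infsum_0)
    have "ell2_inner S (grad N (h n)) \<phi> = I * g n p" for n
    proof -
      have "ell2_inner S (grad N (g n)) \<phi> = I * g n p"
        using g(1)[of n] ev unfolding fs_def S_def by blast
      then show ?thesis
        using ell2_inner_add_left[OF f_ell2 fs_ell2[OF g(1)[of n]], of \<phi>] \<phi>(1) f0
        by (simp add: grad_h g(2) S_def)
    qed
    moreover have "(\<lambda>n. ell2_inner S (grad N (h n)) \<phi>) \<longlonglongrightarrow> ell2_inner S l \<phi>"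
      using ell2_inner_tendsto[OF h_ell2 l _ h_lim] \<phi>(1) by (simp add: S_def)
    moreover have "ell2_inner S l \<phi> = 0"
      unfolding ell2_inner_def by (rule infsum_0) (simp add: l0)
    ultimately have "(\<lambda>n. I * g n p) \<longlonglongrightarrow> 0" by simp
    from tendsto_mult_left[OF this, of "1 / I"] p(2) have "(\<lambda>n. g n p) \<longlonglongrightarrow> 0" by simp
    from tendsto_add[OF tendsto_const this, of b] p(1) H(3)
    have "(\<lambda>n. h n p) \<longlonglongrightarrow> b" by (simp add: h_def)
    with p(1) show ?thesis by blast
  qed
  obtain p q where p: "p \<in> verts H1" "(\<lambda>n. h n p) \<longlonglongrightarrow> c1" and q: "q \<in> verts H2" "(\<lambda>n. h n q) \<longlonglongrightarrow> c2"
    using key[OF H1] key[OF H2] by blast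
  have pq: "p \<in> verts N" "q \<in> verts N"
    using p(1) q(1) H1(1) H2(1) by (auto simp: subnetwork_def)
  \<comment> \<open>The right side is 0 since \<open>k\<close> is constant, contradicting the
    distinct values of \<open>f\<close>.\<close>
  have "c1 - c2 = k p - k q"
    using tendsto_diff[OF p(2) q(2)] k_diff[OF pq] by (rule LIMSEQ_unique)
  with c pq \<open>c1 \<noteq> c2\<close> show False by simp
qed

subsection \<open>Components\<close>

text \<open>The union of \<open>C\<close> and \<open>D\<close> is connected through a common vertex,
  so maximality of \<open>C\<close> makes it equal to \<open>C\<close>.\<close>

lemma component_absorbs:
  assumes C: "C \<in> net_components M" and D: "subnetwork D M" "net_connected D"
    and meet: "verts C \<inter> verts D \<noteq> {}"
  shows "subnetwork D C"
proof -
  from C have C': "subnetwork C M" "net_connected C"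
    and max: "\<And>D. subnetwork D M \<Longrightarrow> net_connected D \<Longrightarrow> subnetwork C D \<Longrightarrow> D = C"
    unfolding net_components_def by auto
  define U where "U = M\<lparr>verts := verts C \<union> verts D, edges := edges C \<union> edges D\<rparr>"
  have U: "verts U = verts C \<union> verts D" "edges U = edges C \<union> edges D" "ends U = ends M" "res U = res M"
    by (simp_all add: U_def)
  obtain z where z: "z \<in> verts C" "z \<in> verts D" using meet by blast
  have paths: "(adjacent U)\<^sup>*\<^sup>* x y" if "x \<in> verts K" "y \<in> verts K" "K = C \<or> K = D" for x y K
  proof -
    have "adjacent K \<le> adjacent U"
    proof (rule predicate2I)
      fix a b assume "adjacent K a b"
      then obtain e where "e \<in> edges K" "ends K e = {a, b}" by (auto simp: adjacent_def)
      then have "e \<in> edges U" "ends U e = {a, b}"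
        using that(3) C'(1) D(1) unfolding U subnetwork_def by auto
      then show "adjacent U a b" by (auto simp: adjacent_def)
    qed
    moreover have "(adjacent K)\<^sup>*\<^sup>* x y"
      using that C'(2) D(2) by (auto simp: net_connected_def)
    ultimately show ?thesis using rtranclp_mono by blast
  qed
  have "(adjacent U)\<^sup>*\<^sup>* x z \<and> (adjacent U)\<^sup>*\<^sup>* z x" if "x \<in> verts U" for x
    using that paths z unfolding U by blast
  then have "net_connected U"
    using z U(1) unfolding net_connected_def by (blast intro: rtranclp_trans)
  moreover have "is_network U"
    unfolding is_network_def
  proof
    fix e assume "e \<in> edges U"
    then obtain K where K: "K = C \<or> K = D" "e \<in> edges K" unfolding U by blast
    have "subnetwork K M" using K(1) C'(1) D(1) by blast
    with K(2) have "ends M e \<subseteq> verts K \<and> card (ends M e) \<in> {1, 2} \<and> res M e > 0"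
      unfolding subnetwork_def is_network_def by metis
    then show "ends U e \<subseteq> verts U \<and> card (ends U e) \<in> {1, 2} \<and> res U e > 0"
      using K(1) unfolding U by blast
  qed
  then have "subnetwork U M" "subnetwork C U"
    using C'(1) D(1) unfolding subnetwork_def U by auto
  ultimately have "U = C" by (intro max)
  then show ?thesis using C'(1) D(1) U unfolding subnetwork_def by auto
qed

text \<open>A single edge with its ends, possibly a loop, is a connected subnetwork and is
  absorbed.\<close>

lemma component_ends:
  assumes "is_network M" "C \<in> net_components M" "e \<in> edges M" "ends M e \<inter> verts C \<noteq> {}"
  shows "ends M e \<subseteq> verts C"
proof -
  define E where "E = M\<lparr>verts := ends M e, edges := {e}\<rparr>"
  have E: "verts E = ends M e" "edges E = {e}" "ends E = ends M" "res E = res M"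
    by (simp_all add: E_def)
  have sub: "subnetwork E M"
    using assms(1,3) by (auto simp: subnetwork_def E is_network_def)
  have "(adjacent E)\<^sup>*\<^sup>* x y" if "x \<in> ends M e" "y \<in> ends M e" for x y
  proof (cases "x = y")
    case False
    have "card (ends M e) \<in> {1, 2}" using assms(1,3) by (auto simp: is_network_def)
    with that False have "ends M e = {x, y}" by (auto simp: card_1_singleton_iff card_2_iff)
    then have "adjacent E x y" by (simp add: adjacent_def E)
    then show ?thesis by blast
  qed simp
  then have "net_connected E" using assms(4) unfolding net_connected_def E by blast
  with component_absorbs[OF assms(2) sub] assms(4) have "subnetwork E C" unfolding E by blast
  then show ?thesis by (auto simp: subnetwork_def E)
qed

text \<open>If they met, \<open>C\<close> would absorb \<open>D\<close>, and maximality of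
  \<open>D\<close> would force equality.\<close>

lemma components_disjoint:
  assumes "C \<in> net_components M" "D \<in> net_components M" "C \<noteq> D"
  shows "verts C \<inter> verts D = {}"
proof (rule ccontr)
  assume "verts C \<inter> verts D \<noteq> {}"
  then have "subnetwork D C"
    using assms by (intro component_absorbs[OF assms(1)]) (auto simp: net_components_def)
  with assms show False by (auto simp: net_components_def)
qed

theorem corollary1p3:
  fixes N :: "('v, 'e) network"
  assumes "is_network N" and "net_connected N" and "locally_finite N"
    and "\<exists>F. is_cut N F \<and> (\<lambda>e. 1 / res N e) summable_on F \<and>
           (\<exists>C\<in>net_components (delete_edges N F). \<exists>D\<in>net_components (delete_edges N F).
              C \<noteq> D \<and> contains_transient C \<and> contains_transient D)"
  shows "N \<notin> O_HD"
proof -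
  from assms(4) obtain F C D where F: "(\<lambda>e. 1 / res N e) summable_on F"
    and C: "C \<in> net_components (delete_edges N F)" and D: "D \<in> net_components (delete_edges N F)"
    and "C \<noteq> D" "contains_transient C" "contains_transient D" by blast
  then obtain H1 H2 where H: "subnetwork H1 C" "transient H1" "subnetwork H2 D" "transient H2"
    unfolding contains_transient_def by blast
  let ?M = "delete_edges N F"
  have M: "is_network ?M" "subnetwork ?M N"
    using assms(1) by (auto simp: is_network_def subnetwork_def delete_edges_def)
  have "subnetwork C ?M" "subnetwork D ?M" using C D by (auto simp: net_components_def)
  with H M(2) have sub: "subnetwork H1 N" "subnetwork H2 N" by (blast intro: subnetwork_trans)+
  define f :: "'v \<Rightarrow> real" where "f x = of_bool (x \<in> verts C)" for x
  \<comment> \<open>A summable majorant for the energy of \<open>f\<close>: the conductances of the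
    cut, extended by zero.\<close>
  have "(\<lambda>e. if e \<in> F then 1 / res N e else 0) summable_on nonloops N
      \<longleftrightarrow> (\<lambda>e. 1 / res N e) summable_on F \<inter> nonloops N"
    by (rule summable_on_cong_neutral) auto
  also have "\<dots>" using F by (rule summable_on_subset_banach) auto
  finally have "finite_potential_energy N f"
    unfolding finite_potential_energy_def
  proof (rule summable_on_comparison_test)
    fix e assume e: "e \<in> nonloops N"
    note r = res_pos_nonloops[OF assms(1) e]
    obtain x y where xy: "orient N e = (e, x, y)" "(e, x, y) \<in> dedges N"
      using e by (rule orientE)
    show "(f (init (orient N e)) - f (ter (orient N e)))\<^sup>2 / res N e
        \<le> (if e \<in> F then 1 / res N e else 0)"
    \<comment> \<open>An edge outside \<open>F\<close> survives the deletion, so its ends lie both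
      inside or both outside \<open>C\<close> and \<open>f\<close> does not change along it; across
      an edge of \<open>F\<close> it changes by at most 1.\<close>
    proof (cases "e \<in> F")
      case False
      with xy(2) have "e \<in> edges ?M" "ends ?M e = {x, y}"
        by (auto simp: dedges_iff delete_edges_def)
      then have "x \<in> verts C \<longleftrightarrow> y \<in> verts C" using component_ends[OF M(1) C, of e] by auto
      with False xy(1) show ?thesis by (simp add: f_def init_def ter_def)
    qed (use r in \<open>auto simp: f_def divide_right_mono\<close>)
    show "0 \<le> (f (init (orient N e)) - f (ter (orient N e)))\<^sup>2 / res N e" using r by simp
  qed
  moreover have "f x = 1" if "x \<in> verts H1" for x
    using that H(1) by (auto simp: f_def subnetwork_def)
  moreover have "f x = 0" if "x \<in> verts H2" for x
    using that H(3) components_disjoint[OF C D \<open>C \<noteq> D\<close>] by (auto simp: f_def subnetwork_def)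
  ultimately show ?thesis
    using separating_potential_not_O_HD[OF assms(1-3) _ sub(1) H(2) _ sub(2) H(4), of f 1 0] by simp
qed

end
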